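(* Let $\mathbb{F}$ be a finite field, $m>1$ an integer, and $R=\mathbb{F}^{m\times m}$. Then the homogeneous weight partition $\mathcal{P}_{\mathrm{hom}}$ of $R$ is self-dual: for any generating character $\chi$ of $R$, $\mathcal{P}_{\mathrm{hom}}$ equals its left $\chi$-dual partition.
   Context: $\mathcal{P}_{\mathrm{hom}}$ is the partition of $R$ into level sets of the normalized homogeneous weight $\omega$ (the unique map $R\to\mathbb{R}$ with $\omega(0)=0$, $\omega(x)=\omega(y)$ whenever $Rx=Ry$, and $\sum_{y\in Rx}\omega(y)=|Rx|$ for $x\neq0$). Characters are group homomorphisms $(R,+)\to\mathbb{C}^*$; $\widehat{R}$ is an $R$-$R$-bimodule via $(r\cdot\chi)(v)=\chi(vr)$, $(\chi\cdot r)(v)=\chi(rv)$; a generating character is $\chi$ with $\widehat{R}=R\cdot\chi$. For a partition $\mathcal{P}=P_1\mid\cdots\mid P_M$ of $R$, its left $\chi$-dual partition is given by the equivalence relation $b\sim b'$ iff $\sum_{a\in P_i}\chi(ab)=\sum_{a\in P_i}\chi(ab')$ for all $i$. Two partitions are equal if their blocks coincide up to ordering. *)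

theory Defs
  imports "HOL-Analysis.Analysis"
begin

text \<open>The ring R = F^{m x m} is rendered as the type ('a^'n^'n) with matrix product (**),
  where 'a is a finite field and m = CARD('n).\<close>

type_synonym ('a, 'n) sqmat = "'a^'n^'n"

definition left_ideal :: "('a::semiring_1, 'n::finite) sqmat \<Rightarrow> ('a, 'n) sqmat set" where
  "left_ideal x = {r ** x | r. True}"

definition is_normalized_hom_weight ::
  "(('a::{field,finite}, 'n::finite) sqmat \<Rightarrow> real) \<Rightarrow> bool" where
  "is_normalized_hom_weight \<omega> \<longleftrightarrow>
     \<omega> 0 = 0 \<and>
     (\<forall>x y. left_ideal x = left_ideal y \<longrightarrow> \<omega> x = \<omega> y) \<and>
     (\<forall>x. x \<noteq> 0 \<longrightarrow> (\<Sum>y\<in>left_ideal x. \<omega> y) = real (card (left_ideal x)))"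

definition hom_weight :: "('a::{field,finite}, 'n::finite) sqmat \<Rightarrow> real" where
  "hom_weight = (THE \<omega>. is_normalized_hom_weight \<omega>)"

definition hom_partition :: "('a::{field,finite}, 'n::finite) sqmat set set" where
  "hom_partition = (\<lambda>x::('a,'n) sqmat. {y. hom_weight y = hom_weight x}) ` UNIV"

definition is_character :: "(('a::{field,finite}, 'n::finite) sqmat \<Rightarrow> complex) \<Rightarrow> bool" where
  "is_character \<xi> \<longleftrightarrow> (\<forall>a b. \<xi> (a + b) = \<xi> a * \<xi> b) \<and> (\<forall>a. \<xi> a \<noteq> 0)"

definition is_generating_character ::
  "(('a::{field,finite}, 'n::finite) sqmat \<Rightarrow> complex) \<Rightarrow> bool" where
  "is_generating_character \<xi> \<longleftrightarrow> is_character \<xi> \<and>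
     (\<forall>\<psi>. is_character \<psi> \<longrightarrow> (\<exists>r. \<psi> = (\<lambda>v. \<xi> (v ** r))))"

definition left_dual_partition ::
  "(('a::{field,finite}, 'n::finite) sqmat \<Rightarrow> complex) \<Rightarrow> ('a, 'n) sqmat set set
     \<Rightarrow> ('a, 'n) sqmat set set" where
  "left_dual_partition \<xi> P =
     (\<lambda>b. {b'. \<forall>B\<in>P. (\<Sum>a\<in>B. \<xi> (a ** b)) = (\<Sum>a\<in>B. \<xi> (a ** b'))}) ` UNIV"

end

theory Submission
  imports Defs
begin

text \<open>Let \<open>\<psi>\<close> be a nontrivial additive character of \<open>F\<close> and \<open>S x\<close> the sum of \<open>\<psi> (trace (u x))\<close> over
  the units \<open>u\<close> of \<open>R\<close>. Then \<open>1 - S x / S 0\<close> is the homogeneous weight. Up to equivalence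
  \<open>x \<mapsto> u x v\<close> a matrix is a 0-1 diagonal matrix of rank \<open>r\<close>; averaging \<open>S\<close> over all choices of one column
  relates its values at ranks \<open>r\<close> and \<open>r + 1\<close>, and the resulting closed form takes distinct values at
  distinct ranks. So the blocks of the homogeneous weight partition are the equivalence classes.

  A generating character has the form \<open>v \<mapsto> \<psi> (trace (v c))\<close> with \<open>c\<close> a unit. By cyclicity of the trace its
  sums over a block depend only on the equivalence class of \<open>b\<close>, and the sum over the block of the units is
  \<open>S b\<close>, which already separates the classes.\<close>

section \<open>A nontrivial additive character of a finite field\<close>

text \<open>A subgroup \<open>H\<close> of index \<open>p\<close> that misses \<open>1\<close>
  identifies the quotient with the integers modulo \<open>p\<close>, which carry the character
  \<open>cis (2 * pi * n / p)\<close>; missing \<open>1\<close> is what makes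
  \<open>\<psi> 1\<close> differ from \<open>1\<close>.\<close>

lemma exists_nontrivial_additive_character:
  obtains \<psi> :: "'a::{field,finite} \<Rightarrow> complex"
  where "\<And>x y. \<psi> (x + y) = \<psi> x * \<psi> y" "\<And>x. \<psi> x \<noteq> 0" "\<psi> 1 \<noteq> 1"
proof -
  define p where "p = CHAR('a)"
  have p: "prime p"
    unfolding p_def by (rule prime_CHAR_semidom) (rule finite_imp_CHAR_pos, simp)
  have of_int_0_iff: "(of_int k :: 'a) = 0 \<longleftrightarrow> int p dvd k" for k
    unfolding p_def by (rule of_int_eq_0_iff_char_dvd)
  define subgrp where
    "subgrp H \<longleftrightarrow> 0 \<in> H \<and> (\<forall>x\<in>H. \<forall>y\<in>H. x - y \<in> H)" for H :: "'a set"
  have sub_uminus: "- x \<in> H" if "subgrp H" "x \<in> H" for x H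
    using that unfolding subgrp_def by (metis diff_0)
  have sub_add: "x + y \<in> H" if "subgrp H" "x \<in> H" "y \<in> H" for x y H
    using that sub_uminus[of H y] unfolding subgrp_def by (metis diff_minus_eq_add)
  have sub_nat: "of_nat n * x \<in> H" if "subgrp H" "x \<in> H" for x H and n :: nat
  proof (induction n)
    case 0
    then show ?case using that by (simp add: subgrp_def)
  next
    case (Suc n)
    then show ?case using sub_add[OF that(1) that(2) Suc] by (simp add: algebra_simps)
  qed
  have sub_int: "of_int n * x \<in> H" if "subgrp H" "x \<in> H" for x H and n :: int
    using sub_nat[OF that] sub_uminus[OF that(1)] by (cases n) (auto simp del: of_nat_Suc)
  \<comment> \<open>By Bezout, an integer prime to \<open>p\<close> is invertible modulo
    \<open>p\<close>.\<close>
  have inv_int: "\<exists>l. (of_int l * of_int k :: 'a) = 1" if "\<not> int p dvd k" for k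
  proof -
    have "coprime (int p) k"
      using p that by (intro prime_imp_coprime) auto
    then obtain l u where "l * k + u * int p = 1"
      using bezout_int[of k "int p"] by (auto simp: coprime_iff_gcd_eq_1 gcd.commute)
    then have "l * k - 1 = int p * (- u)"
      by (simp add: algebra_simps)
    then have "int p dvd (l * k - 1)"
      by (rule dvdI)
    then show ?thesis
      using of_int_0_iff[of "l * k - 1"] by auto
  qed
  \<comment> \<open>A subgroup maximal among those avoiding \<open>1\<close> has index \<open>p\<close>, with the integers as coset representatives.\<close>
  have "\<exists>H. (subgrp H \<and> 1 \<notin> H) \<and> (\<forall>H'. subgrp H' \<and> 1 \<notin> H' \<longrightarrow> card H' \<le> card H)"
  proof (rule ex_has_greatest_nat)
    show "subgrp {0} \<and> 1 \<notin> {0::'a}"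
      by (simp add: subgrp_def)
    show "\<forall>H'. subgrp H' \<and> 1 \<notin> H' \<longrightarrow> card H' < CARD('a) + 1"
      by (simp add: card_mono less_Suc_eq_le)
  qed
  then obtain H where H: "subgrp H" "1 \<notin> H"
    and Hmax: "\<And>H'. subgrp H' \<Longrightarrow> 1 \<notin> H' \<Longrightarrow> card H' \<le> card H"
    by blast
  have int_notin: "int p dvd k" if "of_int k \<in> H" for k
    using inv_int[of k] sub_int[OF H(1) that] H(2) by metis
  have "\<exists>n. x - of_int n \<in> H" for x
  proof (cases "x \<in> H")
    case True
    then show ?thesis by (intro exI[of _ 0]) simp
  next
    case False
    \<comment> \<open>The subgroup generated by \<open>H\<close> and \<open>x\<close>. Being
      strictly larger than \<open>H\<close>, it contains \<open>1\<close> by maximality, and that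
      relation is solved for \<open>x\<close> modulo \<open>H\<close>.\<close>
    define H' where "H' = {h + of_int k * x | h k. h \<in> H}"
    have mem: "h + of_int k * x \<in> H'" if "h \<in> H" for h k
      unfolding H'_def using that by blast
    have "0 \<in> H"
      using H(1) by (simp add: subgrp_def)
    have "subgrp H'"
      unfolding subgrp_def
    proof (intro conjI ballI)
      show "0 \<in> H'"
        using mem[OF \<open>0 \<in> H\<close>, of 0] by simp
      fix a b assume "a \<in> H'" "b \<in> H'"
      then obtain h k h' k' where hk:
        "h \<in> H" "h' \<in> H" "a = h + of_int k * x" "b = h' + of_int k' * x"
        unfolding H'_def by auto
      then have "h - h' \<in> H"
        using H(1) by (simp add: subgrp_def)
      then show "a - b \<in> H'"
        using mem[of "h - h'" "k - k'"] by (simp add: hk algebra_simps)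
    qed
    moreover have "H \<subset> H'"
    proof
      show "H \<subseteq> H'"
        using mem[of _ 0] by auto
      show "H \<noteq> H'"
        using mem[OF \<open>0 \<in> H\<close>, of 1] False by auto
    qed
    then have "card H < card H'"
      by (simp add: psubset_card_mono)
    ultimately have "1 \<in> H'"
      using Hmax[of H'] by auto
    then obtain h k where hk: "h \<in> H" "1 = h + of_int k * x"
      unfolding H'_def by auto
    \<comment> \<open>Otherwise the multiple of \<open>x\<close> vanishes and \<open>1 = h\<close>
      lies in \<open>H\<close>.\<close>
    have "\<not> int p dvd k"
      using hk H(2) of_int_0_iff[of k] by auto
    then obtain l where l: "(of_int l * of_int k :: 'a) = 1"
      using inv_int by blast
    have "of_int l = of_int l * (h + of_int k * x)"
      using hk(2) by simp
    also have "\<dots> = of_int l * h + x"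
      using l by (simp add: distrib_left flip: mult.assoc)
    finally have "x - of_int l = - (of_int l * h)"
      by (metis add_diff_cancel_right' minus_diff_eq)
    then show ?thesis
      using sub_uminus[OF H(1) sub_int[OF H(1) hk(1)]] by metis
  qed
  then obtain N where N: "\<And>x. x - of_int (N x) \<in> H"
    by metis
  \<comment> \<open>Two choices of \<open>N x\<close> differ by an integer in \<open>H\<close>,
    hence by a multiple of \<open>p\<close> (\<open>int_notin\<close>), so the value does not depend
    on the choice.\<close>
  define \<psi> where "\<psi> x = cis (2 * pi * of_int (N x) / p)" for x
  have cis_eq: "cis (2 * pi * of_int a / p) = cis (2 * pi * of_int b / p) \<longleftrightarrow> int p dvd a - b"
    for a b
  proof -
    have p0: "p > 0"
      using p prime_gt_0_nat by blast
    have "cis (2 * pi * of_int a / p) = cis (2 * pi * of_int b / p) \<longleftrightarrow>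
      (\<exists>n::int. 2 * pi * of_int a / p = 2 * pi * of_int b / p + 2 * pi * n)"
      by (simp add: complex_eq_iff conj_commute flip: sin_cos_eq_iff)
    also have "\<dots> \<longleftrightarrow> (\<exists>n::int. real_of_int a = of_int (b + n * int p))"
    proof (intro ex_cong1)
      fix n :: int
      have "2 * pi * of_int b / p + 2 * pi * n = 2 * pi * of_int (b + n * int p) / p"
        using p0 by (simp add: field_simps)
      then show "2 * pi * of_int a / p = 2 * pi * of_int b / p + 2 * pi * n \<longleftrightarrow>
          real_of_int a = of_int (b + n * int p)"
        using p0 by simp
    qed
    also have "\<dots> \<longleftrightarrow> int p dvd a - b"
      unfolding of_int_eq_iff by (auto simp: dvd_def algebra_simps)
    finally show ?thesis .
  qed
  show ?thesis
  proof
    fix x y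
    \<comment> \<open>Here \<open>x\<close> and \<open>y\<close> cancel, which leaves an integer
      lying in \<open>H\<close>.\<close>
    have "(x + y - of_int (N (x + y))) - (x - of_int (N x) + (y - of_int (N y))) \<in> H"
      using N sub_add[OF H(1)] H(1) unfolding subgrp_def by blast
    then have "of_int (N x + N y - N (x + y)) \<in> H"
      by (simp add: algebra_simps)
    then have "int p dvd N x + N y - N (x + y)"
      by (rule int_notin)
    then have "cis (2 * pi * of_int (N x + N y) / p) = \<psi> (x + y)"
      unfolding \<psi>_def cis_eq .
    then show "\<psi> (x + y) = \<psi> x * \<psi> y"
      unfolding \<psi>_def by (simp add: cis_mult distrib_left add_divide_distrib)
    show "\<psi> x \<noteq> 0"
      by (simp add: \<psi>_def)
  next
    have "\<not> int p dvd N 1"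
      using N[of 1] H(2) of_int_0_iff[of "N 1"] by auto
    then show "\<psi> 1 \<noteq> 1"
      using cis_eq[of "N 1" 0] by (simp add: \<psi>_def)
  qed
qed

section \<open>The rank normal form\<close>

text \<open>Column times row. Row and column operations are written below as factors
  \<open>mat 1 + outer a b\<close>.\<close>

definition outer :: "'a::semiring_1 ^ 'm \<Rightarrow> 'a ^ 'n \<Rightarrow> 'a ^ 'n ^ 'm" where
  "outer a b = (\<chi> i j. a $ i * b $ j)"

text \<open>Indexed by a set of positions because \<open>'n\<close> carries no order; the rank is
  \<open>card K\<close>.\<close>

definition diag01 :: "'n set \<Rightarrow> 'a::semiring_1 ^ 'n ^ 'n" where
  "diag01 K = (\<chi> i j. if i = j \<and> i \<in> K then 1 else 0)"

lemma outer_nth [simp]: "outer a b $ i $ j = a $ i * b $ j"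
  by (simp add: outer_def)

lemma diag01_nth [simp]: "diag01 K $ i $ j = (if i = j \<and> i \<in> K then 1 else 0)"
  by (simp add: diag01_def)

lemma diag01_empty: "diag01 {} = 0"
  by (simp add: vec_eq_iff)

lemma matrix_mult_nth: "(A ** B) $ i $ j = (\<Sum>k\<in>UNIV. A $ i $ k * B $ k $ j)"
  by (simp add: matrix_matrix_mult_def)

lemma matrix_add_rdistrib:
  fixes A :: "'a::semiring_1 ^ 'n ^ 'm"
  shows "(A + B) ** C = A ** C + B ** C"
  by (simp add: vec_eq_iff matrix_mult_nth distrib_right sum.distrib)

lemma id_plus_outer_mult_nth:
  fixes A :: "'a::comm_ring_1 ^ 'k ^ 'n"
  shows "((mat 1 + outer a b) ** A) $ i $ j = A $ i $ j + a $ i * (\<Sum>k\<in>UNIV. b $ k * A $ k $ j)"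
  by (simp add: matrix_mult_nth mat_def distrib_right sum.distrib if_distrib[of "\<lambda>x. x * _"]
      sum.delta sum.delta' sum_distrib_left mult.assoc cong: if_cong)

lemma mult_id_plus_outer_nth:
  fixes A :: "'a::comm_ring_1 ^ 'n ^ 'k"
  shows "(A ** (mat 1 + outer a b)) $ i $ j = A $ i $ j + (\<Sum>k\<in>UNIV. A $ i $ k * a $ k) * b $ j"
  by (simp add: matrix_mult_nth mat_def distrib_left sum.distrib if_distrib[of "\<lambda>x. _ * x"]
      sum.delta sum.delta' sum_distrib_right mult.assoc cong: if_cong)

lemma sum_axis_left [simp]:
  fixes f :: "'n::finite \<Rightarrow> 'a::semiring_1"
  shows "(\<Sum>k\<in>UNIV. axis i 1 $ k * f k) = f i"
  by (simp add: axis_def if_distrib[of "\<lambda>x. x * _"] cong: if_cong)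

lemma sum_axis_right [simp]:
  fixes f :: "'n::finite \<Rightarrow> 'a::semiring_1"
  shows "(\<Sum>k\<in>UNIV. f k * axis i 1 $ k) = f i"
  by (simp add: axis_def if_distrib[of "\<lambda>x. _ * x"] cong: if_cong)

text \<open>The Sherman-Morrison formula: with \<open>c\<close> the scalar in the hypothesis, the
  inverse is \<open>mat 1 + outer a' b\<close> for \<open>a' = - a / c\<close>.\<close>

lemma invertible_id_plus_outer:
  fixes a b :: "'a::field ^ 'n"
  assumes "1 + (\<Sum>k\<in>UNIV. b $ k * a $ k) \<noteq> 0"
  shows "invertible (mat 1 + outer a b)"
proof -
  define c where "c = 1 + (\<Sum>k\<in>UNIV. b $ k * a $ k)"
  define a' where "a' = (\<chi> i. - a $ i / c)"
  have "(\<Sum>k\<in>UNIV. b $ k * (mat 1 + outer a' b) $ k $ j) = b $ j / c" for j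
  proof -
    have "(\<Sum>k\<in>UNIV. b $ k * (mat 1 + outer a' b) $ k $ j) =
        b $ j - (\<Sum>k\<in>UNIV. b $ k * a $ k) * (b $ j / c)"
      by (simp add: a'_def mat_def right_diff_distrib sum_subtractf if_distrib[of "\<lambda>x. _ * x"]
          sum_distrib_right mult.assoc sum_divide_distrib cong: if_cong)
    also have "\<dots> = b $ j / c"
      using assms by (simp add: c_def field_simps)
    finally show ?thesis .
  qed
  then have "(mat 1 + outer a b) ** (mat 1 + outer a' b) = mat 1"
    by (simp only: vec_eq_iff id_plus_outer_mult_nth)
      (simp add: a'_def mat_def)
  then show ?thesis
    unfolding invertible_right_inverse by blast
qed

section \<open>Equivalence of matrices and its 0-1 diagonal representatives\<close>

definition equivalent_mat :: "'a::semiring_1 ^ 'n ^ 'n \<Rightarrow> 'a ^ 'n ^ 'n \<Rightarrow> bool" where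
  "equivalent_mat x y \<longleftrightarrow> (\<exists>u v. invertible u \<and> invertible v \<and> y = u ** x ** v)"

lemma equivalent_matI: "invertible u \<Longrightarrow> invertible v \<Longrightarrow> equivalent_mat x (u ** x ** v)"
  unfolding equivalent_mat_def by blast

lemma invertible_mat_1: "invertible (mat 1)"
  unfolding invertible_def by (intro exI[of _ "mat 1"]) simp

lemma equivalent_mat_refl [simp]: "equivalent_mat x x"
  unfolding equivalent_mat_def by (intro exI[of _ "mat 1"]) (simp add: invertible_mat_1)

lemma equivalent_mat_trans:
  "equivalent_mat x y \<Longrightarrow> equivalent_mat y z \<Longrightarrow> equivalent_mat x z"
  unfolding equivalent_mat_def by (metis invertible_mult matrix_mul_assoc)

lemma equivalent_mat_sym:
  fixes x y :: "'a::semiring_1 ^ 'n ^ 'n"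
  assumes "equivalent_mat x y"
  shows "equivalent_mat y x"
proof -
  obtain u v where uv: "invertible u" "invertible v" "y = u ** x ** v"
    using assms unfolding equivalent_mat_def by blast
  then obtain u' v' where inv: "u ** u' = mat 1" "u' ** u = mat 1" "v ** v' = mat 1" "v' ** v = mat 1"
    unfolding invertible_def by blast
  have "u' ** y ** v' = (u' ** u) ** x ** (v ** v')"
    by (simp only: uv(3) matrix_mul_assoc)
  then have "x = u' ** y ** v'"
    by (simp add: inv)
  moreover have "invertible u'" "invertible v'"
    using inv unfolding invertible_def by blast+
  ultimately show ?thesis
    unfolding equivalent_mat_def by blast
qed

lemma equivalent_mat_multL: "invertible u \<Longrightarrow> equivalent_mat x (u ** x)"
  unfolding equivalent_mat_def by (metis invertible_mat_1 matrix_mul_rid)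

lemma equivalent_mat_multR: "invertible v \<Longrightarrow> equivalent_mat x (x ** v)"
  unfolding equivalent_mat_def by (metis invertible_mat_1 matrix_mul_lid)

lemma equivalent_mat_invertible: "equivalent_mat x y \<Longrightarrow> invertible x \<Longrightarrow> invertible y"
  unfolding equivalent_mat_def by (metis invertible_mult)

text \<open>The invariant of Gaussian elimination: \<open>K\<close> holds the finished pivots, and
  the remainder \<open>z\<close> lives outside their rows and columns. Each round moves one index
  into \<open>K\<close>.\<close>

lemma equivalent_mat_diag01_plus:
  fixes z :: "'a::field ^ 'n ^ 'n"
  assumes "\<And>i j. i \<in> K \<or> j \<in> K \<Longrightarrow> z $ i $ j = 0"
  shows "\<exists>L. equivalent_mat (diag01 K + z) (diag01 L)"
  using assms
proof (induction "card (- K)" arbitrary: K z rule: less_induct)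
  case less
  show ?case
  proof (cases "z = 0")
    case True
    then show ?thesis by (intro exI[of _ K]) simp
  next
    case False
    then obtain i j where ij: "z $ i $ j \<noteq> 0"
      by (auto simp: vec_eq_iff)
    then have iK: "i \<notin> K"
      using less.prems by blast
    \<comment> \<open>Gaussian elimination with pivot \<open>(i, i)\<close>: make it nonzero, normalize column \<open>i\<close>, then clear row \<open>i\<close>.\<close>
    obtain z1 where z1: "equivalent_mat (diag01 K + z) (diag01 K + z1)" "z1 $ i $ i \<noteq> 0"
      "\<And>k l. k \<in> K \<or> l \<in> K \<Longrightarrow> z1 $ k $ l = 0"
    proof (cases "z $ i $ i = 0")
      case True
      \<comment> \<open>Column \<open>j\<close> is added to column \<open>i\<close>, so the entry at
        \<open>(i, i)\<close> becomes \<open>z $ i $ j\<close>; as \<open>j\<close> is not in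
        \<open>K\<close>, \<open>diag01 K\<close> is unaffected.\<close>
      define z1 where "z1 = (\<chi> k l. z $ k $ l + z $ k $ j * axis i 1 $ l)"
      have "j \<notin> K" "i \<noteq> j"
        using ij less.prems True by auto
      then have "(diag01 K + z) ** (mat 1 + outer (axis j 1) (axis i 1)) = diag01 K + z1"
        by (auto simp add: vec_eq_iff mult_id_plus_outer_nth z1_def)
      moreover have "invertible (mat 1 + outer (axis j 1) (axis i 1) :: 'a ^ 'n ^ 'n)"
        using \<open>i \<noteq> j\<close> by (intro invertible_id_plus_outer) (simp, simp add: axis_def)
      ultimately have "equivalent_mat (diag01 K + z) (diag01 K + z1)"
        by (metis equivalent_mat_multR)
      moreover have "z1 $ i $ i \<noteq> 0"
        using True ij by (simp add: z1_def axis_def)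
      moreover have "z1 $ k $ l = 0" if "k \<in> K \<or> l \<in> K" for k l
        using that less.prems iK by (auto simp: z1_def axis_def)
      ultimately show ?thesis
        using that by blast
    next
      case False
      then show ?thesis
        using that[of z] less.prems by simp
    qed
    define c where "c = z1 $ i $ i"
    \<comment> \<open>The multiples of row \<open>i\<close> that turn column \<open>i\<close> into
      the unit vector \<open>axis i 1\<close>.\<close>
    define a where "a = (\<chi> k. (axis i 1 $ k - z1 $ k $ i) / c)"
    define z2 where "z2 = (\<chi> k l. z1 $ k $ l + a $ k * z1 $ i $ l)"
    have c: "c \<noteq> 0"
      using z1 by (simp add: c_def)
    have "(mat 1 + outer a (axis i 1)) ** (diag01 K + z1) = diag01 K + z2"
      using iK by (auto simp add: vec_eq_iff id_plus_outer_mult_nth z2_def)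
    moreover have "invertible (mat 1 + outer a (axis i 1))"
    proof (intro invertible_id_plus_outer)
      have "1 + a $ i = 1 / c"
        using c by (simp add: a_def c_def field_simps)
      then show "1 + (\<Sum>k\<in>UNIV. axis i 1 $ k * a $ k) \<noteq> 0"
        using c by simp
    qed
    ultimately have eq2: "equivalent_mat (diag01 K + z1) (diag01 K + z2)"
      by (metis equivalent_mat_multL)
    have z2_i: "z2 $ k $ i = axis i 1 $ k" for k
      using c by (simp add: z2_def a_def c_def[symmetric])
    have z2_K: "z2 $ k $ l = 0" if "k \<in> K \<or> l \<in> K" for k l
      using that z1(3) iK by (auto simp: z2_def a_def axis_def)
    \<comment> \<open>Column \<open>i\<close> is now a unit vector, so adding its multiples
      \<open>b\<close> to the columns changes row \<open>i\<close> only and clears it off the pivot.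
      The pivot itself is then moved from \<open>z3\<close> to
      \<open>diag01 (insert i K)\<close>.\<close>
    define b where "b = axis i 1 - z2 $ i"
    define z3 where "z3 = (\<chi> k l. z2 $ k $ l + axis i 1 $ k * b $ l - axis i 1 $ k * axis i 1 $ l)"
    have b_i: "b $ i = 0"
      by (simp add: b_def z2_i)
    have "(diag01 K + z2) ** (mat 1 + outer (axis i 1) b) = diag01 (insert i K) + z3"
      using iK by (auto simp add: vec_eq_iff mult_id_plus_outer_nth z3_def z2_i) (auto simp: axis_def)
    moreover have "invertible (mat 1 + outer (axis i 1) b)"
      by (intro invertible_id_plus_outer) (simp add: b_i)
    ultimately have eq3: "equivalent_mat (diag01 K + z2) (diag01 (insert i K) + z3)"
      by (metis equivalent_mat_multR)
    have "card (- insert i K) < card (- K)"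
      using iK by (intro psubset_card_mono) auto
    moreover have "z3 $ k $ l = 0" if "k \<in> insert i K \<or> l \<in> insert i K" for k l
      using that z2_K z2_i b_i iK by (auto simp: z3_def b_def axis_def)
    ultimately obtain L where "equivalent_mat (diag01 (insert i K) + z3) (diag01 L)"
      using less.hyps[of "insert i K" z3] by blast
    then show ?thesis
      using z1(1) eq2 eq3 equivalent_mat_trans by blast
  qed
qed

lemma equivalent_mat_diag01:
  fixes x :: "'a::field ^ 'n ^ 'n"
  obtains K where "equivalent_mat x (diag01 K)"
  using equivalent_mat_diag01_plus[of "{}" x] by (auto simp: diag01_empty)

text \<open>The entry type is arbitrary, so the count applies to vectors and also to matrices as
  vectors of rows.\<close>

lemma card_vec_restricted:
  fixes A :: "'n::finite \<Rightarrow> 'b set"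
  shows "card {v :: 'b ^ 'n. \<forall>i. v $ i \<in> A i} = (\<Prod>i\<in>UNIV. card (A i))"
proof -
  have "bij_betw vec_nth {v :: 'b ^ 'n. \<forall>i. v $ i \<in> A i} (PiE UNIV A)"
    by (rule bij_betwI[where g = vec_lambda]) auto
  then show ?thesis
    by (simp add: bij_betw_same_card card_PiE)
qed

text \<open>The column space of \<open>diag01 K\<close>, written as a product of entry sets to fit
  \<open>card_vec_restricted\<close>.\<close>

definition vec_supp_in :: "'n set \<Rightarrow> ('a::zero ^ 'n) set" where
  "vec_supp_in K = {v. \<forall>i. v $ i \<in> (if i \<in> K then UNIV else {0})}"

lemma vec_supp_in_iff: "v \<in> vec_supp_in K \<longleftrightarrow> (\<forall>i. i \<notin> K \<longrightarrow> v $ i = 0)"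
  by (auto simp: vec_supp_in_def)

lemma card_vec_supp_in:
  "card (vec_supp_in K :: ('a::{zero,finite} ^ 'n::finite) set) = CARD('a) ^ card K"
proof -
  have "card (vec_supp_in K :: ('a ^ 'n) set) =
      (\<Prod>i\<in>UNIV. card (if i \<in> K then UNIV else {0 :: 'a}))"
    unfolding vec_supp_in_def by (rule card_vec_restricted)
  also have "\<dots> = (\<Prod>i\<in>UNIV. if i \<in> K then CARD('a) else 1)"
    by (intro prod.cong) auto
  also have "\<dots> = CARD('a) ^ card K"
    by (simp add: prod.If_cases)
  finally show ?thesis .
qed

lemma diag01_row_sum:
  fixes f :: "'n::finite \<Rightarrow> 'a::semiring_1"
  shows "(\<Sum>l\<in>UNIV. diag01 K $ i $ l * f l) = (if i \<in> K then f i else 0)"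
  by (auto simp: if_distrib[of "\<lambda>x. x * _"] cong: if_cong)

lemma diag01_col_sum:
  fixes f :: "'n::finite \<Rightarrow> 'a::semiring_1"
  shows "(\<Sum>l\<in>UNIV. f l * diag01 K $ l $ j) = (if j \<in> K then f j else 0)"
  by (auto simp: if_distrib[of "\<lambda>x. _ * x"] cong: if_cong conj_cong)

text \<open>Bijections \<open>K\<close> to \<open>L\<close> and between the complements glue to a
  permutation \<open>h\<close> of the indices, whose permutation matrix conjugates one diagonal into
  the other.\<close>

lemma equivalent_mat_diag01_same_card:
  fixes K L :: "'n::finite set"
  assumes "card K = card L"
  shows "equivalent_mat (diag01 K :: 'a::field ^ 'n ^ 'n) (diag01 L)"
proof -
  have "card (- K) = card (- L)"
    using assms by (simp add: Compl_eq_Diff_UNIV card_Diff_subset)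
  then obtain f g where f: "bij_betw f K L" and g: "bij_betw g (- K) (- L)"
    using assms finite_same_card_bij[of K L] finite_same_card_bij[of "- K" "- L"] by auto
  define h where "h i = (if i \<in> K then f i else g i)" for i
  have hL: "h i \<in> L \<longleftrightarrow> i \<in> K" for i
    using bij_betwE[OF f] bij_betwE[OF g] by (auto simp: h_def)
  have h_inj: "i = j" if "h i = h j" for i j
  proof (cases "i \<in> K")
    case True
    then have "j \<in> K"
      using hL that by metis
    then show ?thesis
      using True that f by (auto simp: h_def bij_betw_def inj_on_eq_iff)
  next
    case False
    then have "j \<notin> K"
      using hL that by metis
    then show ?thesis
      using False that g by (auto simp: h_def bij_betw_def inj_on_eq_iff)
  qed
  define P :: "'a ^ 'n ^ 'n" where "P = (\<chi> i j. if i = h j then 1 else 0)"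
  have "(transpose P ** P) $ i $ j = mat 1 $ i $ j" for i j
    using h_inj by (auto simp: matrix_mult_nth P_def transpose_def mat_def
        if_distrib[of "\<lambda>x. x * _"] cong: if_cong)
  then have "transpose P ** P = mat 1"
    by (simp add: vec_eq_iff)
  then have "invertible P"
    unfolding invertible_left_inverse by blast
  moreover have "(diag01 L ** P) $ i $ j = (P ** diag01 K) $ i $ j" for i j
    unfolding matrix_mult_nth diag01_row_sum diag01_col_sum using hL by (auto simp: P_def)
  then have "diag01 L ** P = P ** diag01 K"
    by (simp add: vec_eq_iff)
  ultimately show ?thesis
    by (metis equivalent_mat_multL equivalent_mat_multR equivalent_mat_sym equivalent_mat_trans)
qed

text \<open>Since \<open>diag01 K\<close> fixes \<open>v\<close>, the extra column is a combination
  of the others and arises by a column operation.\<close>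

lemma equivalent_mat_diag01_plus_column_inside:
  fixes v :: "'a::field ^ 'n"
  assumes "k \<notin> K" "v \<in> vec_supp_in K"
  shows "equivalent_mat (diag01 K) (diag01 K + outer v (axis k 1))"
proof -
  have "diag01 K ** (mat 1 + outer v (axis k 1)) = diag01 K + outer v (axis k 1)"
    using assms unfolding vec_supp_in_iff
    by (simp only: vec_eq_iff mult_id_plus_outer_nth diag01_row_sum) auto
  moreover have "invertible (mat 1 + outer v (axis k 1))"
    using assms by (intro invertible_id_plus_outer) (simp add: vec_supp_in_iff)
  ultimately show ?thesis
    by (metis equivalent_mat_multR)
qed

text \<open>If \<open>v $ k\<close> is nonzero, a unit fixing the other basis vectors sends
  \<open>axis k 1\<close> to \<open>v\<close>. The remaining case is reduced to this one.\<close>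

lemma equivalent_mat_diag01_plus_column_outside:
  fixes v :: "'a::field ^ 'n"
  assumes "k \<notin> K" "v \<notin> vec_supp_in K"
  shows "equivalent_mat (diag01 (insert k K)) (diag01 K + outer v (axis k 1))"
proof -
  have nonzero: "equivalent_mat (diag01 (insert k K)) (diag01 K + outer v (axis k 1))"
    if "v $ k \<noteq> 0" for v :: "'a ^ 'n"
  proof -
    have "(mat 1 + outer (v - axis k 1) (axis k 1)) ** diag01 (insert k K) =
        diag01 K + outer v (axis k 1)"
      using assms(1) by (auto simp: vec_eq_iff id_plus_outer_mult_nth) (auto simp: axis_def)
    moreover have "invertible (mat 1 + outer (v - axis k 1) (axis k 1))"
      using that by (intro invertible_id_plus_outer, subst sum_axis_left) (simp add: axis_def)
    ultimately show ?thesis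
      by (metis equivalent_mat_multL)
  qed
  show ?thesis
  proof (cases "v $ k = 0")
    case True
    obtain j where j: "j \<notin> K" "v $ j \<noteq> 0"
      using assms(2) by (auto simp: vec_supp_in_iff)
    then have "j \<noteq> k"
      using True by auto
    \<comment> \<open>Row \<open>j\<close> is added to row \<open>k\<close>; this leaves
      \<open>diag01 K\<close> alone because \<open>j\<close> is not in \<open>K\<close>.\<close>
    define v' where "v' = (\<chi> i. v $ i + v $ j * axis k 1 $ i)"
    have "(mat 1 + outer (axis k 1) (axis j 1)) ** (diag01 K + outer v (axis k 1)) =
        diag01 K + outer v' (axis k 1)"
      using j by (auto simp: vec_eq_iff id_plus_outer_mult_nth v'_def) (simp_all add: algebra_simps)
    moreover have "invertible (mat 1 + outer (axis k 1) (axis j 1) :: 'a ^ 'n ^ 'n)"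
      using \<open>j \<noteq> k\<close> by (intro invertible_id_plus_outer, subst sum_axis_left) (simp add: axis_def)
    ultimately have "equivalent_mat (diag01 K + outer v (axis k 1)) (diag01 K + outer v' (axis k 1))"
      by (metis equivalent_mat_multL)
    moreover have "v' $ k \<noteq> 0"
      using j True by (simp add: v'_def axis_def)
    ultimately show ?thesis
      using nonzero equivalent_mat_sym equivalent_mat_trans by blast
  qed (rule nonzero)
qed

section \<open>Left ideals and normalized homogeneous weights\<close>

lemma finite_left_ideal [simp]: "finite (left_ideal (x :: ('a::{field,finite}, 'n::finite) sqmat))"
  by (rule finite_subset[OF subset_UNIV finite_class.finite_UNIV])

lemma left_ideal_self: "x \<in> left_ideal x"
  unfolding left_ideal_def by (metis (mono_tags, lifting) matrix_mul_lid mem_Collect_eq)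

lemma left_ideal_mono: "y \<in> left_ideal x \<Longrightarrow> left_ideal y \<subseteq> left_ideal x"
  unfolding left_ideal_def using matrix_mul_assoc by blast

lemma left_ideal_add:
  fixes x :: "('a::semiring_1, 'n::finite) sqmat"
  shows "y \<in> left_ideal x \<Longrightarrow> z \<in> left_ideal x \<Longrightarrow> y + z \<in> left_ideal x"
  unfolding left_ideal_def
  by clarsimp (metis matrix_add_rdistrib)

text \<open>The rows of a member range independently over \<open>vec_supp_in K\<close>. The size of
  a left ideal thus reveals the rank of its generator.\<close>

lemma card_left_ideal_diag01:
  "card (left_ideal (diag01 K :: ('a::{field,finite}, 'n::finite) sqmat)) =
    (CARD('a) ^ card K) ^ CARD('n)"
proof -
  have nth: "(r ** diag01 K) $ i $ j = (if j \<in> K then r $ i $ j else 0)"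
    for r :: "('a, 'n) sqmat" and i j
    unfolding matrix_mult_nth diag01_col_sum ..
  have "left_ideal (diag01 K) = {y :: ('a, 'n) sqmat. \<forall>i. y $ i \<in> vec_supp_in K}"
  proof (intro set_eqI iffI)
    fix y :: "('a, 'n) sqmat"
    assume "y \<in> {y. \<forall>i. y $ i \<in> vec_supp_in K}"
    then have "y = y ** diag01 K"
      by (auto simp: vec_supp_in_iff vec_eq_iff nth)
    then show "y \<in> left_ideal (diag01 K)"
      unfolding left_ideal_def by blast
  qed (auto simp: left_ideal_def vec_supp_in_iff nth)
  then show ?thesis
    by (simp add: card_vec_restricted card_vec_supp_in)
qed

text \<open>The left factor is absorbed by the ideal, and the right factor maps one ideal
  bijectively onto the other.\<close>

lemma card_left_ideal_equivalent:
  assumes "equivalent_mat x y"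
  shows "card (left_ideal x) = card (left_ideal y)"
proof -
  obtain u v where uv: "invertible u" "invertible v" "y = u ** x ** v"
    using assms unfolding equivalent_mat_def by blast
  obtain u' where u': "u' ** u = mat 1"
    using uv(1) unfolding invertible_def by blast
  obtain v' where v': "v ** v' = mat 1"
    using uv(2) unfolding invertible_def by blast
  have "left_ideal y = (\<lambda>w. w ** v) ` left_ideal x"
  proof (intro set_eqI iffI)
    fix w assume "w \<in> left_ideal y"
    then obtain r where "w = r ** (u ** x ** v)"
      unfolding left_ideal_def uv(3) by blast
    then have "w = ((r ** u) ** x) ** v"
      by (simp only: matrix_mul_assoc)
    then show "w \<in> (\<lambda>w. w ** v) ` left_ideal x"
      unfolding left_ideal_def by blast
  next
    fix w assume "w \<in> (\<lambda>w. w ** v) ` left_ideal x"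
    then obtain r where r: "w = (r ** x) ** v"
      unfolding left_ideal_def by blast
    have "(r ** u') ** y = r ** (u' ** u) ** x ** v"
      by (simp only: uv(3) matrix_mul_assoc)
    then have "w = (r ** u') ** y"
      using r u' by simp
    then show "w \<in> left_ideal y"
      unfolding left_ideal_def by blast
  qed
  moreover have "inj_on (\<lambda>w. w ** v) (left_ideal x)"
    by (rule inj_on_inverseI[where g = "\<lambda>w. w ** v'"])
      (simp add: v' flip: matrix_mul_assoc)
  ultimately show ?thesis
    by (simp add: card_image)
qed

text \<open>On the generators of a left ideal a normalized homogeneous weight is constant, and the remaining
  elements generate smaller left ideals, so the normalization determines it by induction.\<close>

lemma is_normalized_hom_weight_unique:
  fixes \<omega> \<omega>' :: "('a::{field,finite}, 'n::finite) sqmat \<Rightarrow> real"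
  assumes \<omega>: "is_normalized_hom_weight \<omega>" and \<omega>': "is_normalized_hom_weight \<omega>'"
  shows "\<omega> = \<omega>'"
proof
  fix x
  show "\<omega> x = \<omega>' x"
  proof (induction "card (left_ideal x)" arbitrary: x rule: less_induct)
    case less
    show ?case
    proof (cases "x = 0")
      case True
      then show ?thesis
        using \<omega> \<omega>' by (simp add: is_normalized_hom_weight_def)
    next
      case False
      define G where "G = {y \<in> left_ideal x. left_ideal y = left_ideal x}"
      have G: "G \<subseteq> left_ideal x" "finite G" "card G \<noteq> 0"
        using left_ideal_self[of x] by (auto simp: G_def card_eq_0_iff)
      have split: "real (card (left_ideal x)) = real (card G) * w x + (\<Sum>y\<in>left_ideal x - G. w y)"
        if w: "is_normalized_hom_weight w" for w
      proof -
        have "(\<Sum>y\<in>left_ideal x. w y) = real (card (left_ideal x))"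
          using w False unfolding is_normalized_hom_weight_def by blast
        then have "real (card (left_ideal x)) = (\<Sum>y\<in>left_ideal x. w y)"
          by (rule sym)
        also have "\<dots> = (\<Sum>y\<in>left_ideal x - G. w y) + (\<Sum>y\<in>G. w y)"
          using G by (intro sum.subset_diff) auto
        also have "(\<Sum>y\<in>G. w y) = (\<Sum>y\<in>G. w x)"
          using w unfolding is_normalized_hom_weight_def G_def by (intro sum.cong) blast+
        finally show ?thesis by simp
      qed
      have "\<omega> y = \<omega>' y" if "y \<in> left_ideal x - G" for y
      proof (rule less.hyps)
        have "left_ideal y \<subset> left_ideal x"
          using that left_ideal_mono[of y x] by (auto simp: G_def)
        then show "card (left_ideal y) < card (left_ideal x)"
          by (intro psubset_card_mono) auto
      qed
      then have "(\<Sum>y\<in>left_ideal x - G. \<omega> y) = (\<Sum>y\<in>left_ideal x - G. \<omega>' y)"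
        by (rule sum.cong[OF refl])
      then have "real (card G) * \<omega> x = real (card G) * \<omega>' x"
        using split[OF \<omega>] split[OF \<omega>'] by linarith
      then show ?thesis
        using G by simp
    qed
  qed
qed

section \<open>Character sums over the general linear group\<close>

text \<open>Translation by \<open>a\<close> permutes the finite set \<open>A\<close>, so the sum
  equals \<open>c\<close> times itself.\<close>

lemma sum_translation_eq_0:
  fixes f :: "'b::group_add \<Rightarrow> 'c::idom"
  assumes "finite A" "\<And>x. x \<in> A \<Longrightarrow> x + a \<in> A" "\<And>x. x \<in> A \<Longrightarrow> f (x + a) = c * f x" "c \<noteq> 1"
  shows "sum f A = 0"
proof -
  have "inj_on (\<lambda>x. x + a) A"
    by simp
  moreover have "(\<lambda>x. x + a) ` A = A"
    using assms(1,2) by (intro endo_inj_surj) auto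
  ultimately have "sum f A = (\<Sum>x\<in>A. f (x + a))"
    using sum.reindex[of "\<lambda>x. x + a" A f] by simp
  also have "\<dots> = c * sum f A"
    using assms(3) by (simp add: sum_distrib_left)
  finally show ?thesis
    using assms(4) by simp
qed

section \<open>The coefficients of the closed form and their separation\<close>

lemma two_le_card_field: "2 \<le> CARD('a::{field,finite})"
proof -
  have "card {0, 1 :: 'a} \<le> CARD('a)"
    by (intro card_mono) auto
  then show ?thesis by simp
qed

text \<open>The modulus of \<open>S x / S 0\<close> at rank \<open>r\<close>, in the recursive form
  delivered by the averaging: \<open>q ^ r\<close> vectors lie in a coordinate subspace of dimension
  \<open>r\<close>, and \<open>q ^ m - q ^ r\<close> lie outside.\<close>

primrec gl_coeff :: "nat \<Rightarrow> nat \<Rightarrow> nat \<Rightarrow> real" where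
  "gl_coeff q m 0 = 1"
| "gl_coeff q m (Suc r) = gl_coeff q m r * (real q ^ r / (real q ^ m - real q ^ r))"

lemma gl_coeff_pos:
  assumes "q \<ge> 2" "r \<le> m"
  shows "gl_coeff q m r > 0"
  using assms(2)
proof (induction r)
  case (Suc r)
  then have "real q ^ r < real q ^ m"
    using assms(1) by (intro power_strict_increasing) auto
  then show ?case
    using Suc assms(1) by simp
qed simp

text \<open>The factor is \<open>1 / (q ^ (m - r) - 1)\<close>, which is \<open>1\<close> only for
  \<open>q = 2\<close> and \<open>r = m - 1\<close>.\<close>

lemma gl_coeff_Suc_le:
  assumes "q \<ge> 2" "r < m"
  shows "gl_coeff q m (Suc r) \<le> gl_coeff q m r"
    and "Suc r < m \<Longrightarrow> gl_coeff q m (Suc r) < gl_coeff q m r"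
proof -
  have pos: "gl_coeff q m r > 0"
    using gl_coeff_pos[OF assms(1), of r m] assms(2) by simp
  have q: "real q ^ r > 0"
    using assms by simp
  have step: "2 * real q ^ n \<le> real q ^ Suc n" for n
    using assms(1) by simp
  have le: "real q ^ Suc r \<le> real q ^ m"
    using assms by (intro power_increasing) auto
  have le': "real q ^ r \<le> real q ^ m - real q ^ r"
    using step[of r] le by linarith
  then have "real q ^ r / (real q ^ m - real q ^ r) \<le> 1"
    using q divide_le_eq_1_pos[of "real q ^ m - real q ^ r" "real q ^ r"] by linarith
  then show "gl_coeff q m (Suc r) \<le> gl_coeff q m r"
    using pos unfolding gl_coeff.simps by (intro mult_left_le) auto
  assume "Suc r < m"
  then have "real q ^ Suc r < real q ^ m"
    using assms(1) by (intro power_strict_increasing) auto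
  then have "real q ^ r < real q ^ m - real q ^ r"
    using step[of r] by linarith
  then have "real q ^ r / (real q ^ m - real q ^ r) < 1"
    using q divide_less_eq_1_pos[of "real q ^ m - real q ^ r" "real q ^ r"] by linarith
  then show "gl_coeff q m (Suc r) < gl_coeff q m r"
    using mult_strict_left_mono[of "real q ^ r / (real q ^ m - real q ^ r)" 1 "gl_coeff q m r"] pos
    by (simp only: gl_coeff.simps mult_1_right)
qed

text \<open>The modulus may stay constant at the last step (for \<open>q = 2\<close>), where only the sign separates the values.\<close>

lemma gl_coeff_signed_inj:
  assumes "q \<ge> 2"
  shows "inj_on (\<lambda>r. (-1) ^ r * gl_coeff q m r) {..m}"
proof (rule linorder_inj_onI)
  fix r s assume rs: "r < s" "r \<in> {..m}" "s \<in> {..m}"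
  have pos: "gl_coeff q m r > 0" "gl_coeff q m s > 0"
    using gl_coeff_pos[OF assms] rs by auto
  show "(-1) ^ r * gl_coeff q m r \<noteq> (-1) ^ s * gl_coeff q m s"
  proof
    assume eq: "(-1) ^ r * gl_coeff q m r = (-1) ^ s * gl_coeff q m s"
    then have "\<bar>(-1) ^ r * gl_coeff q m r\<bar> = \<bar>(-1) ^ s * gl_coeff q m s\<bar>"
      by simp
    then have same: "gl_coeff q m r = gl_coeff q m s"
      using pos by (simp add: abs_mult power_abs)
    show False
    \<comment> \<open>Neighbouring ranks differ in sign. Otherwise the step from \<open>r\<close> to
      \<open>Suc r\<close> is not the last one, so the modulus drops strictly.\<close>
    proof (cases "s = Suc r")
      case True
      have "(-1) ^ r * gl_coeff q m s = (-1) ^ s * gl_coeff q m s"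
        using eq unfolding same .
      then have "(-1 :: real) ^ r = (-1) ^ s"
        using pos by (simp only: mult_cancel_right) auto
      then show False
        by (simp add: True)
    next
      case False
      then have "gl_coeff q m (Suc r) < gl_coeff q m r"
        using rs by (intro gl_coeff_Suc_le(2) assms) auto
      moreover have "gl_coeff q m s \<le> gl_coeff q m (Suc r)"
      proof -
        have "Suc r \<le> s" "s \<le> m"
          using rs by auto
        then show ?thesis
        proof (induction s rule: dec_induct)
          case (step n)
          then show ?case
            using gl_coeff_Suc_le(1)[OF assms, of n m] by simp
        qed simp
      qed
      ultimately show False
        using same by simp
    qed
  qed
qed auto

section \<open>Vanishing sums and invariance for a nontrivial additive character\<close>

locale additive_character =
  fixes \<psi> :: "'a::{field,finite} \<Rightarrow> complex"
  assumes add: "\<psi> (x + y) = \<psi> x * \<psi> y"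
    and nonzero: "\<psi> x \<noteq> 0"
    and nontrivial: "\<psi> 1 \<noteq> 1"
begin

lemma zero [simp]: "\<psi> 0 = 1"
  using add[of 0 0] nonzero[of 0] by simp

lemma sum_linear_form_eq_0:
  fixes w :: "'a ^ 'n"
  assumes "w \<noteq> 0"
  shows "(\<Sum>v\<in>UNIV. \<psi> (\<Sum>i\<in>UNIV. w $ i * v $ i)) = 0"
proof -
  obtain i where i: "w $ i \<noteq> 0"
    using assms by (auto simp: vec_eq_iff)
  \<comment> \<open>The linear form takes the value \<open>1\<close> at \<open>a\<close>, so
    translation by \<open>a\<close> multiplies each term by \<open>\<psi> 1\<close>.\<close>
  define a where "a = (\<chi> j. axis i 1 $ j / w $ i)"
  have "(\<Sum>j\<in>UNIV. w $ j * a $ j) = (\<Sum>j\<in>UNIV. (w $ j / w $ i) * axis i 1 $ j)"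
    by (simp add: a_def)
  also have "\<dots> = 1"
    using i by (subst sum_axis_right) simp
  finally show ?thesis
    using nontrivial
    by (intro sum_translation_eq_0[where a = a and c = "\<psi> 1"])
      (simp_all add: distrib_left sum.distrib add mult.commute)
qed

text \<open>Nondegeneracy of the trace form, twisted by a unit; it supplies the translations that
  make character sums over left ideals vanish.\<close>

lemma left_ideal_trace_1:
  fixes x u :: "('a, 'n::finite) sqmat"
  assumes "x \<noteq> 0" "invertible u"
  shows "\<exists>a\<in>left_ideal x. trace (u ** a) = 1"
proof -
  obtain i j where ij: "x $ i $ j \<noteq> 0"
    using assms(1) by (auto simp: vec_eq_iff)
  obtain u' where u': "u ** u' = mat 1"
    using assms(2) unfolding invertible_def by blast
  \<comment> \<open>A scaled matrix unit: \<open>r ** x\<close> has row \<open>i\<close> of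
    \<open>x\<close>, divided by \<open>x $ i $ j\<close>, as its row \<open>j\<close>, and zeros
    elsewhere.\<close>
  define r where "r = outer (axis j 1) (\<chi> k. axis i 1 $ k / x $ i $ j)"
  have "(\<Sum>k\<in>UNIV. axis i 1 $ k / x $ i $ j * x $ k $ l) = x $ i $ l / x $ i $ j" for l
    using sum_axis_left[of i "\<lambda>k. x $ k $ l / x $ i $ j"] by simp
  moreover have "(r ** x) $ k $ l =
      axis j 1 $ k * (\<Sum>k\<in>UNIV. axis i 1 $ k / x $ i $ j * x $ k $ l)" for k l
    unfolding r_def matrix_mult_nth sum_distrib_left by (simp add: mult.assoc)
  ultimately have "(r ** x) $ k $ l = axis j 1 $ k * (x $ i $ l / x $ i $ j)" for k l
    by simp
  then have "trace (r ** x) = 1"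
    using ij by (simp only: trace_def sum_axis_left) simp
  moreover have "u ** ((u' ** r) ** x) = r ** x"
    by (simp add: matrix_mul_assoc u')
  ultimately show ?thesis
    unfolding left_ideal_def by (metis (mono_tags, lifting) mem_Collect_eq)
qed

lemma sum_left_ideal_eq_0:
  fixes x u :: "('a, 'n::finite) sqmat"
  assumes "x \<noteq> 0" "invertible u"
  shows "(\<Sum>y\<in>left_ideal x. \<psi> (trace (u ** y))) = 0"
proof -
  obtain a where a: "a \<in> left_ideal x" "trace (u ** a) = 1"
    using left_ideal_trace_1[OF assms] by blast
  then show ?thesis
    using nontrivial
    by (intro sum_translation_eq_0[where a = a and c = "\<psi> 1"])
      (simp_all add: left_ideal_add matrix_add_ldistrib trace_add add)
qed

text \<open>Substituting \<open>q ** a ** p\<close> for \<open>a\<close> permutes \<open>B\<close>.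
  Any set closed under equivalence is allowed, so the lemma serves both the units and the blocks of
  the partition.\<close>

lemma sum_trace_mult_equivalent:
  fixes x y :: "('a, 'n::finite) sqmat"
  assumes B: "\<And>a b. a \<in> B \<Longrightarrow> equivalent_mat a b \<Longrightarrow> b \<in> B"
    and "equivalent_mat x y"
  shows "(\<Sum>a\<in>B. \<psi> (trace (a ** y))) = (\<Sum>a\<in>B. \<psi> (trace (a ** x)))"
proof -
  obtain p q where pq: "invertible p" "invertible q" "y = p ** x ** q"
    using assms(2) unfolding equivalent_mat_def by blast
  then obtain p' q' where inv:
    "p ** p' = mat 1" "p' ** p = mat 1" "q ** q' = mat 1" "q' ** q = mat 1"
    unfolding invertible_def by blast
  have inv': "invertible p'" "invertible q'"
    using inv unfolding invertible_def by blast+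
  have cancel: "q' ** (q ** a ** p) ** p' = a" "q ** (q' ** a ** p') ** p = a" for a
  proof -
    have "q' ** (q ** a ** p) ** p' = (q' ** q) ** a ** (p ** p')"
      by (simp only: matrix_mul_assoc)
    then show "q' ** (q ** a ** p) ** p' = a"
      by (simp add: inv)
    have "q ** (q' ** a ** p') ** p = (q ** q') ** a ** (p' ** p)"
      by (simp only: matrix_mul_assoc)
    then show "q ** (q' ** a ** p') ** p = a"
      by (simp add: inv)
  qed
  have mem: "q ** a ** p \<in> B" "q' ** a ** p' \<in> B" if "a \<in> B" for a
    by (intro B[OF that] equivalent_matI pq inv')+
  have "trace (a ** y) = trace ((q ** a ** p) ** x)" for a
    unfolding pq(3) using trace_mul_sym[of "a ** p ** x" q] by (simp only: matrix_mul_assoc)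
  then have "(\<Sum>a\<in>B. \<psi> (trace (a ** y))) = (\<Sum>a\<in>B. \<psi> (trace ((q ** a ** p) ** x)))"
    by simp
  also have "\<dots> = (\<Sum>a\<in>B. \<psi> (trace (a ** x)))"
    by (rule sum.reindex_bij_witness[where i = "\<lambda>a. q' ** a ** p'" and j = "\<lambda>a. q ** a ** p"])
      (simp_all add: cancel mem)
  finally show ?thesis .
qed

text \<open>The sum called \<open>S\<close> in the overview.\<close>

definition gl_sum :: "('a, 'n::finite) sqmat \<Rightarrow> complex" where
  "gl_sum x = (\<Sum>u | invertible u. \<psi> (trace (u ** x)))"

lemma gl_sum_equivalent:
  fixes x y :: "('a, 'n::finite) sqmat"
  assumes "equivalent_mat x y"
  shows "gl_sum y = gl_sum x"
  unfolding gl_sum_def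
  by (rule sum_trace_mult_equivalent[OF _ assms]) (use equivalent_mat_invertible in blast)

lemma gl_sum_0: "gl_sum (0 :: ('a, 'n::finite) sqmat) = of_nat (card {u :: ('a, 'n) sqmat. invertible u})"
  by (simp add: gl_sum_def trace_def matrix_mult_nth)

lemma sum_gl_sum_left_ideal:
  fixes x :: "('a, 'n::finite) sqmat"
  assumes "x \<noteq> 0"
  shows "(\<Sum>y\<in>left_ideal x. gl_sum y) = 0"
  unfolding gl_sum_def
  by (subst sum.swap) (simp add: sum_left_ideal_eq_0[OF assms])

text \<open>Average \<open>gl_sum\<close> over all matrices whose column \<open>k\<close> is arbitrary and whose other columns agree with
  those of \<open>diag01 K\<close>. Each unit contributes \<open>0\<close>, as its row \<open>k\<close> is nonzero; the rank is \<open>card K\<close> if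
  column \<open>k\<close> lies in the span of the other columns, and \<open>card K + 1\<close> otherwise.\<close>

lemma gl_sum_diag01_insert:
  fixes k :: "'n::finite"
  assumes "k \<notin> K"
  shows "of_nat (CARD('a) ^ card K) * gl_sum (diag01 K :: ('a, 'n) sqmat) +
    (of_nat (CARD('a) ^ CARD('n)) - of_nat (CARD('a) ^ card K)) *
      gl_sum (diag01 (insert k K) :: ('a, 'n) sqmat) = 0"
proof -
  let ?y = "\<lambda>v :: 'a ^ 'n. diag01 K + outer v (axis k 1) :: ('a, 'n) sqmat"
  have inner: "(\<Sum>v\<in>UNIV. \<psi> (trace (u ** ?y v))) = 0" if "invertible u" for u :: "('a, 'n) sqmat"
  proof -
    obtain u' where "u ** u' = mat 1"
      using \<open>invertible u\<close> unfolding invertible_def by blast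
    then have "(u ** u') $ k $ k = 1"
      by (simp add: mat_def)
    then have "(\<Sum>l\<in>UNIV. u $ k $ l * u' $ l $ k) = 1"
      unfolding matrix_mult_nth .
    then have "u $ k \<noteq> 0"
      by auto
    \<comment> \<open>Only column \<open>k\<close> of the second factor is nonzero, so the trace is
      a linear form in \<open>v\<close> given by row \<open>k\<close> of \<open>u\<close>.\<close>
    have "trace (u ** outer v (axis k 1)) = (\<Sum>i\<in>UNIV. u $ k $ i * v $ i)" for v
    proof -
      have "trace (u ** outer v (axis k 1)) =
          (\<Sum>j\<in>UNIV. (\<Sum>i\<in>UNIV. u $ j $ i * v $ i) * axis k 1 $ j)"
        by (simp add: trace_def matrix_mult_nth sum_distrib_right mult.assoc)
      then show ?thesis
        by simp
    qed
    then have "(\<Sum>v\<in>UNIV. \<psi> (trace (u ** ?y v))) =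
        \<psi> (trace (u ** diag01 K)) * (\<Sum>v\<in>UNIV. \<psi> (\<Sum>i\<in>UNIV. u $ k $ i * v $ i))"
      by (simp add: matrix_add_ldistrib trace_add add sum_distrib_left)
    then show ?thesis
      using sum_linear_form_eq_0[OF \<open>u $ k \<noteq> 0\<close>] by simp
  qed
  have "0 = (\<Sum>v\<in>UNIV. gl_sum (?y v))"
    unfolding gl_sum_def by (subst sum.swap) (simp add: inner)
  also have "\<dots> = (\<Sum>v\<in>vec_supp_in K. gl_sum (?y v)) + (\<Sum>v\<in>- vec_supp_in K. gl_sum (?y v))"
    by (subst sum.union_disjoint[symmetric]) auto
  also have "(\<Sum>v\<in>vec_supp_in K. gl_sum (?y v)) =
      (\<Sum>v\<in>(vec_supp_in K :: ('a ^ 'n) set). gl_sum (diag01 K :: ('a, 'n) sqmat))"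
    using assms
    by (intro sum.cong gl_sum_equivalent equivalent_mat_diag01_plus_column_inside) auto
  also have "(\<Sum>v\<in>- vec_supp_in K. gl_sum (?y v)) =
      (\<Sum>v\<in>- (vec_supp_in K :: ('a ^ 'n) set). gl_sum (diag01 (insert k K) :: ('a, 'n) sqmat))"
    using assms
    by (intro sum.cong gl_sum_equivalent equivalent_mat_diag01_plus_column_outside) auto
  finally have sum_0: "of_nat (card (vec_supp_in K :: ('a ^ 'n) set)) * gl_sum (diag01 K :: ('a, 'n) sqmat) +
      of_nat (card (- vec_supp_in K :: ('a ^ 'n) set)) * gl_sum (diag01 (insert k K) :: ('a, 'n) sqmat) = 0"
    by simp
  have "card K \<le> CARD('n)"
    by (intro card_mono) auto
  then have "CARD('a) ^ card K \<le> CARD('a) ^ CARD('n)"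
    by (intro power_increasing) (auto simp: Suc_le_eq)
  then have "(of_nat (card (- vec_supp_in K :: ('a ^ 'n) set)) :: complex) =
      of_nat (CARD('a) ^ CARD('n)) - of_nat (CARD('a) ^ card K)"
    by (simp add: Compl_eq_Diff_UNIV card_Diff_subset card_vec_supp_in of_nat_diff del: of_nat_power)
  then show ?thesis
    using sum_0 by (simp only: card_vec_supp_in)
qed

text \<open>Each new pivot multiplies the sum by \<open>- q ^ r / (q ^ m - q ^ r)\<close>; the
  divisor is nonzero because \<open>r < m\<close> before the insertion.\<close>

lemma gl_sum_diag01:
  fixes K :: "'n::finite set"
  shows "gl_sum (diag01 K :: ('a, 'n) sqmat) =
    of_real ((-1) ^ card K * gl_coeff CARD('a) CARD('n) (card K)) * gl_sum (0 :: ('a, 'n) sqmat)"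
  using finite[of K]
proof (induction K rule: finite_induct)
  case empty
  show ?case by (simp add: diag01_empty)
next
  case (insert k K)
  let ?p = "of_nat (CARD('a) ^ card K) :: complex"
  let ?d = "of_nat (CARD('a) ^ CARD('n)) - of_nat (CARD('a) ^ card K) :: complex"
  have "card K < CARD('n)"
    using insert.hyps by (intro psubset_card_mono) auto
  then have "CARD('a) ^ card K < CARD('a) ^ CARD('n)"
    using two_le_card_field[where 'a = 'a] by (intro power_strict_increasing) auto
  then have d: "?d \<noteq> 0"
    unfolding right_minus_eq of_nat_eq_iff by simp
  have "?d * gl_sum (diag01 (insert k K) :: ('a, 'n) sqmat) = - ?p * gl_sum (diag01 K :: ('a, 'n) sqmat)"
    using gl_sum_diag01_insert[OF insert.hyps(2)]
    by (simp only: mult_minus_left eq_neg_iff_add_eq_0 add.commute)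
  moreover have "g' = - p / d * g" if "d * g' = - p * g" "d \<noteq> 0" for d g g' p :: complex
    using that by (simp add: field_simps)
  ultimately have "gl_sum (diag01 (insert k K) :: ('a, 'n) sqmat) =
      - ?p / ?d * gl_sum (diag01 K :: ('a, 'n) sqmat)"
    using d by blast
  then show ?case
    unfolding insert.IH using insert.hyps by simp
qed

lemma gl_sum_0_neq_0: "gl_sum (0 :: ('a, 'n::finite) sqmat) \<noteq> 0"
proof -
  have "mat 1 \<in> {u :: ('a, 'n) sqmat. invertible u}"
    by (simp add: invertible_mat_1)
  then have "card {u :: ('a, 'n) sqmat. invertible u} \<noteq> 0"
    by (metis card_0_eq empty_iff finite_class.finite)
  then show ?thesis
    unfolding gl_sum_0 by simp
qed

text \<open>Taking the real part loses nothing: the quotient is real by \<open>gl_sum_diag01\<close>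
  and the normal form.\<close>

definition gl_weight :: "('a, 'n::finite) sqmat \<Rightarrow> real" where
  "gl_weight x = 1 - Re (gl_sum x / gl_sum (0 :: ('a, 'n) sqmat))"

lemma gl_weight_diag01:
  fixes x :: "('a, 'n::finite) sqmat"
  assumes "equivalent_mat x (diag01 K)"
  shows "gl_weight x = 1 - (-1) ^ card K * gl_coeff CARD('a) CARD('n) (card K)"
proof -
  have "gl_sum x = of_real ((-1) ^ card K * gl_coeff CARD('a) CARD('n) (card K)) *
      gl_sum (0 :: ('a, 'n) sqmat)"
    by (rule trans[OF gl_sum_equivalent[OF equivalent_mat_sym[OF assms]] gl_sum_diag01])
  then have "gl_sum x / gl_sum (0 :: ('a, 'n) sqmat) =
      of_real ((-1) ^ card K * gl_coeff CARD('a) CARD('n) (card K))"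
    using nonzero_mult_div_cancel_right[OF gl_sum_0_neq_0] by (rule ssubst)
  then show ?thesis
    unfolding gl_weight_def by (simp only: Re_complex_of_real)
qed

lemma gl_weight_eq_iff_card:
  fixes x y :: "('a, 'n::finite) sqmat"
  assumes x: "equivalent_mat x (diag01 K)" and y: "equivalent_mat y (diag01 L)"
  shows "gl_weight x = gl_weight y \<longleftrightarrow> card K = card L"
proof -
  have "card K \<in> {..CARD('n)}" "card L \<in> {..CARD('n)}"
    by (auto intro: card_mono)
  then have "(-1) ^ card K * gl_coeff CARD('a) CARD('n) (card K) =
      (-1) ^ card L * gl_coeff CARD('a) CARD('n) (card L) \<longleftrightarrow> card K = card L"
    by (rule inj_on_eq_iff[OF gl_coeff_signed_inj[OF two_le_card_field]])
  then show ?thesis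
    by (simp add: gl_weight_diag01[OF x] gl_weight_diag01[OF y])
qed

lemma gl_weight_eq_iff_equivalent:
  fixes x y :: "('a, 'n::finite) sqmat"
  shows "gl_weight x = gl_weight y \<longleftrightarrow> equivalent_mat x y"
proof
  assume eq: "gl_weight x = gl_weight y"
  obtain K where K: "equivalent_mat x (diag01 K)"
    using equivalent_mat_diag01 by blast
  obtain L where L: "equivalent_mat y (diag01 L)"
    using equivalent_mat_diag01 by blast
  have "card K = card L"
    using eq gl_weight_eq_iff_card[OF K L] by simp
  then show "equivalent_mat x y"
    using equivalent_mat_diag01_same_card K L equivalent_mat_sym equivalent_mat_trans by blast
qed (simp add: gl_weight_def gl_sum_equivalent)

text \<open>Equal left ideals have equal size, hence generators of equal rank.\<close>

lemma gl_weight_left_ideal: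
  fixes x y :: "('a, 'n::finite) sqmat"
  assumes "left_ideal x = left_ideal y"
  shows "gl_weight x = gl_weight y"
proof -
  obtain K where K: "equivalent_mat x (diag01 K)"
    using equivalent_mat_diag01 by blast
  obtain L where L: "equivalent_mat y (diag01 L)"
    using equivalent_mat_diag01 by blast
  have "(CARD('a) ^ card K) ^ CARD('n) = (CARD('a) ^ card L) ^ CARD('n)"
    using assms card_left_ideal_equivalent[OF K] card_left_ideal_equivalent[OF L]
    by (simp add: card_left_ideal_diag01)
  then have "CARD('a) ^ card K = CARD('a) ^ card L"
    by (rule power_eq_imp_eq_base) auto
  then have "card K = card L"
    using two_le_card_field[where 'a = 'a] by (simp add: power_inject_exp)
  then show ?thesis
    by (simp add: gl_weight_eq_iff_card[OF K L])
qed

text \<open>Over a nonzero left ideal the constant \<open>1\<close> sums to the cardinality and the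
  character part sums to zero.\<close>

lemma is_normalized_hom_weight_gl_weight:
  "is_normalized_hom_weight (gl_weight :: ('a, 'n::finite) sqmat \<Rightarrow> real)"
  unfolding is_normalized_hom_weight_def
proof (intro conjI allI impI)
  show "gl_weight (0 :: ('a, 'n) sqmat) = 0"
    using gl_sum_0_neq_0 by (simp add: gl_weight_def)
  show "gl_weight x = gl_weight y" if "left_ideal x = left_ideal y" for x y :: "('a, 'n) sqmat"
    using that by (rule gl_weight_left_ideal)
  show "(\<Sum>y\<in>left_ideal x. gl_weight y) = real (card (left_ideal x))" if "x \<noteq> 0"
    for x :: "('a, 'n) sqmat"
    using sum_gl_sum_left_ideal[OF that]
    by (simp add: gl_weight_def sum_subtractf flip: Re_sum sum_divide_distrib)
qed

lemma hom_weight_eq_gl_weight: "hom_weight = (gl_weight :: ('a, 'n::finite) sqmat \<Rightarrow> real)"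
  unfolding hom_weight_def
  by (intro the_equality is_normalized_hom_weight_gl_weight
      is_normalized_hom_weight_unique[OF _ is_normalized_hom_weight_gl_weight])

text \<open>If \<open>v ** r = v' ** r\<close>, then
  \<open>\<psi> (trace (w ** v)) = \<psi> (trace (w ** v'))\<close> for all \<open>w\<close>, which
  nondegeneracy of the trace form excludes unless \<open>v = v'\<close>. By finiteness, right
  multiplication by \<open>r\<close> is then onto and reaches \<open>mat 1\<close>.\<close>

lemma invertible_of_nondegenerate:
  fixes r :: "('a, 'n::finite) sqmat"
  assumes "\<And>v. \<psi> (trace v) = \<xi> (v ** r)"
  shows "invertible r"
proof -
  have "inj (\<lambda>v :: ('a, 'n) sqmat. v ** r)"
  proof (rule injI, rule ccontr)
    fix v v' :: "('a, 'n) sqmat"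
    assume eq: "v ** r = v' ** r" and "v \<noteq> v'"
    then have "v - v' \<noteq> 0"
      by simp
    then obtain a where a: "a \<in> left_ideal (v - v')" "trace a = 1"
      using left_ideal_trace_1[of "v - v'" "mat 1"] invertible_mat_1 by auto
    then obtain w where "trace (w ** (v - v')) = 1"
      unfolding left_ideal_def by blast
    then have "trace (w ** v) = 1 + trace (w ** v')"
      by (metis diff_add_cancel matrix_add_ldistrib trace_add)
    then have "\<psi> (trace (w ** v)) = \<psi> 1 * \<psi> (trace (w ** v'))"
      by (simp add: add)
    moreover have "\<psi> (trace (w ** v)) = \<psi> (trace (w ** v'))"
      unfolding assms using eq by (simp flip: matrix_mul_assoc)
    ultimately show False
      using nonzero[of "trace (w ** v')"] nontrivial by simp
  qed
  then have "surj (\<lambda>v :: ('a, 'n) sqmat. v ** r)"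
    by (rule finite_UNIV_inj_surj[OF finite_class.finite_UNIV])
  then show ?thesis
    unfolding invertible_left_inverse by (metis surjD)
qed

lemma is_character_trace: "is_character (\<lambda>v :: ('a, 'n::finite) sqmat. \<psi> (trace v))"
  by (simp add: is_character_def trace_add add nonzero)

end

theorem theorem5p9:
  fixes \<xi> :: "('a::{field,finite}, 'n::finite) sqmat \<Rightarrow> complex"
  assumes "CARD('n) > 1"
    and "is_generating_character \<xi>"
  shows "left_dual_partition \<xi> (hom_partition :: ('a, 'n) sqmat set set) = hom_partition"
proof -
  obtain \<psi> :: "'a \<Rightarrow> complex"
    where \<psi>: "\<And>x y. \<psi> (x + y) = \<psi> x * \<psi> y" "\<And>x. \<psi> x \<noteq> 0" "\<psi> 1 \<noteq> 1"
    using exists_nontrivial_additive_character by metis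
  interpret additive_character \<psi>
    using \<psi> by unfold_locales
  let ?w = "hom_weight :: ('a, 'n) sqmat \<Rightarrow> real"
  \<comment> \<open>The generating property expresses the trace character through
    \<open>\<xi>\<close>; inverting \<open>r\<close> then expresses \<open>\<xi>\<close> through the
    trace character.\<close>
  obtain r where r: "\<And>v :: ('a, 'n) sqmat. \<psi> (trace v) = \<xi> (v ** r)"
    using assms(2) is_character_trace unfolding is_generating_character_def by metis
  then have "invertible r"
    by (rule invertible_of_nondegenerate)
  then obtain c where c: "c ** r = mat 1" "r ** c = mat 1"
    unfolding invertible_def by blast
  then have "invertible c"
    unfolding invertible_def by blast
  have \<xi>: "\<xi> v = \<psi> (trace (v ** c))" for v
    by (simp add: r c flip: matrix_mul_assoc)
  have weight_eq_iff: "?w x = ?w y \<longleftrightarrow> equivalent_mat y x" for x y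
    by (metis hom_weight_eq_gl_weight gl_weight_eq_iff_equivalent)
  have closed: "b \<in> B" if "B \<in> hom_partition" "a \<in> B" "equivalent_mat a b"
    for B and a b :: "('a, 'n) sqmat"
    using that by (auto simp: hom_partition_def weight_eq_iff intro: equivalent_mat_trans)
  \<comment> \<open>The unit \<open>c\<close> is absorbed into \<open>b\<close>, since
    \<open>b ** c\<close> is equivalent to \<open>b\<close>.\<close>
  have sum_\<xi>: "(\<Sum>a\<in>B. \<xi> (a ** b)) = (\<Sum>a\<in>B. \<psi> (trace (a ** b)))"
    if "B \<in> hom_partition" for B and b :: "('a, 'n) sqmat"
    using sum_trace_mult_equivalent[OF closed[OF that] equivalent_mat_multR[OF \<open>invertible c\<close>]]
    by (simp add: \<xi> matrix_mul_assoc)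
  have "(\<forall>B\<in>hom_partition. (\<Sum>a\<in>B. \<xi> (a ** b)) = (\<Sum>a\<in>B. \<xi> (a ** b'))) \<longleftrightarrow> ?w b' = ?w b"
    for b b' :: "('a, 'n) sqmat"
  proof
    \<comment> \<open>The units are the block of the identity, so \<open>gl_sum\<close> is among the
      sums compared by the dual partition.\<close>
    have "{u :: ('a, 'n) sqmat. invertible u} = {u. ?w u = ?w (mat 1)}"
      unfolding weight_eq_iff
      using equivalent_mat_multL[of _ "mat 1"] equivalent_mat_invertible[OF _ invertible_mat_1] by auto
    then have units: "{u :: ('a, 'n) sqmat. invertible u} \<in> hom_partition"
      unfolding hom_partition_def by blast
    assume "\<forall>B\<in>hom_partition. (\<Sum>a\<in>B. \<xi> (a ** b)) = (\<Sum>a\<in>B. \<xi> (a ** b'))"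
    then have "gl_sum b = gl_sum b'"
      using units sum_\<xi>[OF units] by (auto simp: gl_sum_def)
    then show "?w b' = ?w b"
      by (simp add: hom_weight_eq_gl_weight gl_weight_def)
  next
    assume "?w b' = ?w b"
    then have "equivalent_mat b b'"
      by (simp add: weight_eq_iff)
    then show "\<forall>B\<in>hom_partition. (\<Sum>a\<in>B. \<xi> (a ** b)) = (\<Sum>a\<in>B. \<xi> (a ** b'))"
      by (intro ballI) (simp add: sum_\<xi> sum_trace_mult_equivalent[OF closed])
  qed
  then show ?thesis
    unfolding left_dual_partition_def by (simp add: hom_partition_def)
qed

end
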